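(* The non-autonomous system $(X,f_{1,\infty})$ has the quasi-weak specification property (QSP) if and only if $(\mathcal{M}(X),\widetilde{f}_{1,\infty})$ has QSP.
   Context: A non-autonomous (discrete) system $(X,f_{1,\infty})$ consists of a compact metric space $(X,d)$ and a sequence $f_{1,\infty}=(f_n)_{n\ge 1}$ of continuous surjective maps $f_n:X\to X$. Write $f_1^n=f_n\circ\cdots\circ f_1$. $\mathcal{M}(X)$ is the set of Borel probability measures on $(X,\mathcal{B}(X))$, where $\mathcal{B}(X)$ is the Borel $\sigma$-algebra, equipped with the Prohorov metric $\mathcal{D}(\mu,\nu)=\inf\{\epsilon>0:\mu(A)\le\nu(N(A,\epsilon))+\epsilon \text{ and } \nu(A)\le\mu(N(A,\epsilon))+\epsilon \text{ for each } A\in\mathcal{B}(X)\}$, where $N(A,\epsilon)=\bigcup_{a\in A}B_d(a,\epsilon)$ and $B_d(a,\epsilon)$ is the open ball (this metric induces the weak*-topology). The induced system is $\widetilde{f}_{1,\infty}=(\widetilde{f}_n)_{n\ge1}$ with $\widetilde{f}_n(\mu)(A)=\mu(f_n^{-1}(A))$. QSP for $(X,f_{1,\infty})$: for every $\epsilon>0$ there is a positive integer $M(\epsilon)$ such that for any $x_1,x_2\in X$ and any $n\ge M(\epsilon)$ there is $z\in X$ with $d(z,x_1)<\epsilon$ and $d(f_1^n(z),f_1^n(x_2))<\epsilon$. For $(\mathcal{M}(X),\widetilde{f}_{1,\infty})$ the same definition is used with the metric $\mathcal{D}$. *)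

theory Defs
  imports "HOL-Probability.Probability"
begin

definition nonautonomous_system :: "'a::metric_space set \<Rightarrow> (nat \<Rightarrow> 'a \<Rightarrow> 'a) \<Rightarrow> bool" where
  "nonautonomous_system X f \<longleftrightarrow>
     compact X \<and> (\<forall>n\<ge>1. continuous_on X (f n) \<and> f n ` X = X)"

(* Sequences of maps are indexed from 1: the value f 0 is never used, and
   iter f n = f n \<circ> ... \<circ> f 1. *)
primrec iter :: "(nat \<Rightarrow> 'b \<Rightarrow> 'b) \<Rightarrow> nat \<Rightarrow> 'b \<Rightarrow> 'b" where
  "iter f 0 = id"
| "iter f (Suc n) = f (Suc n) \<circ> iter f n"

(* The distance d is an explicit argument so that one definition serves both
   for points (dist) and for measures (the Prohorov metric). *)
definition QSP :: "'b set \<Rightarrow> ('b \<Rightarrow> 'b \<Rightarrow> real) \<Rightarrow> (nat \<Rightarrow> 'b \<Rightarrow> 'b) \<Rightarrow> bool" where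
  "QSP S d f \<longleftrightarrow>
     (\<forall>\<epsilon>>0. \<exists>M>0. \<forall>x1\<in>S. \<forall>x2\<in>S. \<forall>n\<ge>M.
        \<exists>z\<in>S. d z x1 < \<epsilon> \<and> d (iter f n z) (iter f n x2) < \<epsilon>)"

definition borel_on :: "'a::metric_space set \<Rightarrow> 'a measure" where
  "borel_on X = restrict_space borel X"

definition borel_probs :: "'a::metric_space set \<Rightarrow> 'a measure set" where
  "borel_probs X = {\<mu>. sets \<mu> = sets (borel_on X) \<and> prob_space \<mu>}"

(* Balls are those of the subspace X, hence the intersection. *)
definition nbhd :: "'a::metric_space set \<Rightarrow> 'a set \<Rightarrow> real \<Rightarrow> 'a set" where
  "nbhd X A \<epsilon> = (\<Union>a\<in>A. ball a \<epsilon> \<inter> X)"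

definition prohorov :: "'a::metric_space set \<Rightarrow> 'a measure \<Rightarrow> 'a measure \<Rightarrow> real" where
  "prohorov X \<mu> \<nu> = Inf {\<epsilon>. \<epsilon> > 0 \<and>
     (\<forall>A\<in>sets (borel_on X).
        measure \<mu> A \<le> measure \<nu> (nbhd X A \<epsilon>) + \<epsilon> \<and>
        measure \<nu> A \<le> measure \<mu> (nbhd X A \<epsilon>) + \<epsilon>)}"

definition induced :: "'a::metric_space set \<Rightarrow> (nat \<Rightarrow> 'a \<Rightarrow> 'a) \<Rightarrow> nat \<Rightarrow> 'a measure \<Rightarrow> 'a measure" where
  "induced X f n \<mu> = distr \<mu> (borel_on X) (f n)"

lemma space_borel_on [simp]: "space (borel_on X) = X"
  by (simp add: borel_on_def space_restrict_space)

lemma measurable_system_map: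
  assumes "nonautonomous_system X f" "n \<ge> 1" "\<mu> \<in> borel_probs X"
  shows "f n \<in> measurable \<mu> (borel_on X)"
proof -
  have "f n \<in> borel_on X \<rightarrow>\<^sub>M borel" "f n \<in> X \<rightarrow> X"
    using assms unfolding nonautonomous_system_def borel_on_def
    by (auto intro!: borel_measurable_continuous_on_restrict)
  then have "f n \<in> borel_on X \<rightarrow>\<^sub>M borel_on X"
    by (auto simp: borel_on_def space_restrict_space intro!: measurable_restrict_space2)
  moreover have "sets \<mu> = sets (borel_on X)"
    using assms(3) by (simp add: borel_probs_def)
  ultimately show ?thesis
    by (simp cong: measurable_cong_sets)
qed

lemma induced_in_borel_probs:
  assumes "nonautonomous_system X f" "n \<ge> 1" "\<mu> \<in> borel_probs X"
  shows "induced X f n \<mu> \<in> borel_probs X"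
  using assms measurable_system_map[OF assms]
  by (auto simp: borel_probs_def induced_def intro: prob_space.prob_space_distr)

lemma measure_induced:
  assumes "nonautonomous_system X f" "n \<ge> 1" "\<mu> \<in> borel_probs X" "A \<in> sets (borel_on X)"
  shows "measure (induced X f n \<mu>) A = measure \<mu> (f n -` A \<inter> X)"
proof -
  have "space \<mu> = X"
    using assms(3) sets_eq_imp_space_eq[of \<mu> "borel_on X"] by (simp add: borel_probs_def)
  then show ?thesis
    using measure_distr[OF measurable_system_map[OF assms(1-3)] assms(4)]
    by (simp add: induced_def)
qed

end

theory Submission imports Defs begin

text \<open>If two random variables on a common probability space are everywhere within \<open>\<epsilon>\<close>, their
  laws are within \<open>\<epsilon>\<close> in the Prohorov metric.  So, to trace \<open>\<mu>1\<close> and then \<open>\<mu>2\<close>, one takes the law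
  of \<open>Z(x, y)\<close> under \<open>\<mu>1 \<otimes> \<mu>2\<close>, where \<open>Z(x, y)\<close> traces \<open>x\<close> and then \<open>y\<close>; measurability of \<open>Z\<close>
  is arranged by first rounding \<open>x\<close> and \<open>y\<close> to a finite net.  Conversely, a measure tracing two
  Dirac measures gives more than half of its mass to the set of points near \<open>x1\<close> and to the set of
  points whose images are near \<open>f\<^sub>1\<^sup>n x2\<close>, so these two sets meet.\<close>

lemma iter_continuous_surj:
  assumes "nonautonomous_system X f"
  shows "continuous_on X (iter f n) \<and> iter f n ` X = X"
proof (induction n)
  case 0
  then show ?case by (simp add: id_def)
next
  case (Suc n)
  have "continuous_on X (f (Suc n))" "f (Suc n) ` X = X"
    using assms by (auto simp: nonautonomous_system_def)
  then show ?case
    using Suc by (simp add: continuous_on_compose image_comp[symmetric] del: o_apply)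
qed

lemma measurable_borel_on_continuous:
  assumes "continuous_on X g" "g ` X \<subseteq> X"
  shows "g \<in> borel_on X \<rightarrow>\<^sub>M borel_on X"
proof -
  have "g \<in> borel_on X \<rightarrow>\<^sub>M borel"
    using assms(1) unfolding borel_on_def by (rule borel_measurable_continuous_on_restrict)
  then show ?thesis
    using assms(2) unfolding borel_on_def
    by (intro measurable_restrict_space2) (auto simp: space_restrict_space)
qed

lemma measurable_iter:
  assumes "nonautonomous_system X f"
  shows "iter f n \<in> borel_on X \<rightarrow>\<^sub>M borel_on X"
  using iter_continuous_surj[OF assms] by (intro measurable_borel_on_continuous) auto

text \<open>Push-forward is functorial, so iterating the induced maps amounts to one push-forward
  along \<open>iter f n\<close>. This turns the second tracing condition into a comparison of two
  laws.\<close>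

lemma iter_induced:
  assumes "nonautonomous_system X f" "\<mu> \<in> borel_probs X"
  shows "iter (induced X f) n \<mu> = distr \<mu> (borel_on X) (iter f n)"
proof (induction n)
  case 0
  have "sets \<mu> = sets (borel_on X)" using assms(2) by (simp add: borel_probs_def)
  then show ?case by (simp add: distr_id2 id_def)
next
  case (Suc n)
  have s: "sets \<mu> = sets (borel_on X)" using assms(2) by (simp add: borel_probs_def)
  have "iter f n \<in> \<mu> \<rightarrow>\<^sub>M borel_on X"
    using measurable_iter[OF assms(1)] s by (simp cong: measurable_cong_sets)
  moreover have "f (Suc n) \<in> borel_on X \<rightarrow>\<^sub>M borel_on X"
    using assms(1) by (intro measurable_borel_on_continuous) (auto simp: nonautonomous_system_def)
  ultimately show ?case
    by (simp add: Suc distr_distr) (simp add: induced_def distr_distr comp_def)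
qed

text \<open>A union of open balls is open whatever \<open>A\<close> is, so no measurability of
  \<open>A\<close> is involved.\<close>

lemma nbhd_sets [measurable]: "nbhd X A \<epsilon> \<in> sets (borel_on X)"
proof -
  have "nbhd X A \<epsilon> = X \<inter> (\<Union>a\<in>A. ball a \<epsilon>)" by (auto simp: nbhd_def)
  moreover have "(\<Union>a\<in>A. ball a \<epsilon>) \<in> sets borel" by (intro borel_open) auto
  ultimately show ?thesis by (auto simp: borel_on_def sets_restrict_space)
qed

lemma prohorov_less_iff:
  assumes "\<mu> \<in> borel_probs X" "\<nu> \<in> borel_probs X"
  shows "prohorov X \<mu> \<nu> < \<epsilon> \<longleftrightarrow> (\<exists>\<delta>>0. \<delta> < \<epsilon> \<and> (\<forall>A\<in>sets (borel_on X).
    measure \<mu> A \<le> measure \<nu> (nbhd X A \<delta>) + \<delta> \<and> measure \<nu> A \<le> measure \<mu> (nbhd X A \<delta>) + \<delta>))"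
    (is "_ \<longleftrightarrow> (\<exists>\<delta>>0. _ \<and> ?P \<delta>)")
proof -
  \<comment> \<open>All masses are at most 1, so 1 is admissible. The infimum is thus over a
    nonempty set, bounded below by 0, and lying below \<open>\<epsilon>\<close> means having an
    admissible element below \<open>\<epsilon>\<close>.\<close>
  have "?P 1"
    using assms by (auto simp: borel_probs_def intro!: order_trans[OF prob_space.prob_le_1])
  then have "1 \<in> {\<delta>. \<delta> > 0 \<and> ?P \<delta>}" by simp
  then have ne: "{\<delta>. \<delta> > 0 \<and> ?P \<delta>} \<noteq> {}" by blast
  have bdd: "bdd_below {\<delta>. \<delta> > 0 \<and> ?P \<delta>}" by (intro bdd_belowI[of _ 0]) auto
  show ?thesis
    unfolding prohorov_def cInf_less_iff[OF ne bdd] by blast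
qed

text \<open>A simple case of the easy half of Strassen's coupling theorem. The gap
  \<open>\<delta> < \<epsilon>\<close> is there because an admissible \<open>\<delta>\<close> bounds
  an infimum only weakly.\<close>

lemma prohorov_distr_less:
  assumes "prob_space P" and U: "U \<in> P \<rightarrow>\<^sub>M borel_on X" and V: "V \<in> P \<rightarrow>\<^sub>M borel_on X"
    and dist: "\<And>\<omega>. \<omega> \<in> space P \<Longrightarrow> dist (U \<omega>) (V \<omega>) < \<delta>" and "0 < \<delta>" "\<delta> < \<epsilon>"
  shows "prohorov X (distr P (borel_on X) U) (distr P (borel_on X) V) < \<epsilon>"
proof -
  interpret prob_space P by fact
  have half: "measure (distr P (borel_on X) U) A \<le> measure (distr P (borel_on X) V) (nbhd X A \<delta>) + \<delta>"
    if "A \<in> sets (borel_on X)" "U \<in> P \<rightarrow>\<^sub>M borel_on X" "V \<in> P \<rightarrow>\<^sub>M borel_on X"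
      "\<And>\<omega>. \<omega> \<in> space P \<Longrightarrow> dist (U \<omega>) (V \<omega>) < \<delta>" for A U V
  proof -
    \<comment> \<open>At each sample point, \<open>U \<omega> \<in> A\<close> puts
      \<open>V \<omega>\<close> into the \<open>\<delta>\<close>-neighbourhood of \<open>A\<close>;
      the inequality of masses is this inclusion of events.\<close>
    have "U -` A \<inter> space P \<subseteq> V -` nbhd X A \<delta> \<inter> space P"
      using that(4) measurable_space[OF that(3)] by (fastforce simp: nbhd_def)
    then have "measure P (U -` A \<inter> space P) \<le> measure P (V -` nbhd X A \<delta> \<inter> space P)"
      using that(3) by (intro finite_measure_mono) auto
    then show ?thesis
      using that \<open>0 < \<delta>\<close> by (simp add: measure_distr)
  qed
  have "distr P (borel_on X) U \<in> borel_probs X" "distr P (borel_on X) V \<in> borel_probs X"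
    using U V by (auto simp: borel_probs_def intro: prob_space_distr)
  then show ?thesis
    using half[OF _ U V dist] half[OF _ V U] dist \<open>0 < \<delta>\<close> \<open>\<delta> < \<epsilon>\<close>
    by (subst prohorov_less_iff) (auto simp: dist_commute)
qed

text \<open>Rounding is split into a measurable index \<open>i\<close> with discrete values and a
  plain function \<open>c\<close>: every function of a discrete index is measurable, so arbitrary
  choices may follow \<open>i\<close>.\<close>

lemma compact_quantization:
  assumes "compact X" "0 < \<delta>"
  obtains i :: "'a::metric_space \<Rightarrow> nat" and c :: "nat \<Rightarrow> 'a"
  where "i \<in> borel_on X \<rightarrow>\<^sub>M count_space UNIV"
    "\<And>x. x \<in> X \<Longrightarrow> c (i x) \<in> X" "\<And>x. x \<in> X \<Longrightarrow> dist (c (i x)) x < \<delta>"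
proof -
  have "X \<subseteq> (\<Union>x\<in>X. ball x \<delta>)" using assms(2) by auto
  then obtain F where F: "finite F" "F \<subseteq> X" "X \<subseteq> (\<Union>x\<in>F. ball x \<delta>)"
    using compactE_image[OF assms(1), of X "\<lambda>x. ball x \<delta>"] open_ball by metis
  obtain n and c :: "nat \<Rightarrow> 'a" where c: "F = c ` {k. k < n}"
    using finite_imp_nat_seg_image_inj_on[OF F(1)] by metis
  \<comment> \<open>Taking the first ball that contains \<open>x\<close> resolves overlaps
    measurably, since each ball is open.\<close>
  define i where "i x = (LEAST k. k < n \<and> x \<in> ball (c k) \<delta>)" for x
  have i: "i x < n \<and> x \<in> ball (c (i x)) \<delta>" if "x \<in> X" for x
    unfolding i_def by (rule LeastI_ex) (use that F(3) c in blast)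
  have "i \<in> borel_on X \<rightarrow>\<^sub>M count_space UNIV"
    unfolding i_def borel_on_def
  proof (intro measurable_restrict_space1 measurable_Least pred_intros_logic)
    show "Measurable.pred borel (\<lambda>x. x \<in> ball (c k) \<delta>)" for k
      unfolding pred_def by (simp del: mem_ball)
  qed simp
  then show ?thesis
  proof (rule that)
    show "c (i x) \<in> X" "dist (c (i x)) x < \<delta>" if "x \<in> X" for x
      using i[OF that] F(2) unfolding c by auto
  qed
qed

lemma QSP_induced:
  assumes sys: "nonautonomous_system X f" and "QSP X dist f"
  shows "QSP (borel_probs X) (prohorov X) (induced X f)"
  unfolding QSP_def
proof (intro allI impI)
  fix \<epsilon> :: real assume "\<epsilon> > 0"
  \<comment> \<open>One quarter of \<open>\<epsilon>\<close> is for tracing and one for rounding;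
    their sum \<open>\<epsilon>/2\<close> leaves the strict gap that
    \<open>prohorov_distr_less\<close> asks for.\<close>
  then obtain M where "M > 0" and M: "\<And>x1 x2 n. x1 \<in> X \<Longrightarrow> x2 \<in> X \<Longrightarrow> n \<ge> M \<Longrightarrow>
      \<exists>z\<in>X. dist z x1 < \<epsilon>/4 \<and> dist (iter f n z) (iter f n x2) < \<epsilon>/4"
    using assms(2) unfolding QSP_def by (metis zero_less_divide_iff zero_less_numeral)
  have "\<exists>\<kappa>\<in>borel_probs X. prohorov X \<kappa> \<mu>1 < \<epsilon> \<and>
      prohorov X (iter (induced X f) n \<kappa>) (iter (induced X f) n \<mu>2) < \<epsilon>"
    if \<mu>1: "\<mu>1 \<in> borel_probs X" and \<mu>2: "\<mu>2 \<in> borel_probs X" and n: "n \<ge> M" for \<mu>1 \<mu>2 n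
  proof -
    have "compact X" using sys by (simp add: nonautonomous_system_def)
    then have "uniformly_continuous_on X (iter f n)"
      using iter_continuous_surj[OF sys] by (intro compact_uniformly_continuous) auto
    \<comment> \<open>This \<open>\<delta>\<close> may depend on \<open>n\<close>, as
      \<open>M\<close> is already fixed. Rounding within \<open>min \<delta> (\<epsilon>/4)\<close>
      then moves the first point by less than \<open>\<epsilon>/4\<close>, and likewise the image of
      the second point under \<open>iter f n\<close>.\<close>
    then obtain \<delta> where "\<delta> > 0" and \<delta>: "\<And>x y. x \<in> X \<Longrightarrow> y \<in> X \<Longrightarrow> dist x y < \<delta> \<Longrightarrow>
        dist (iter f n x) (iter f n y) < \<epsilon>/4"
      using \<open>\<epsilon> > 0\<close> unfolding uniformly_continuous_on_def
      by (metis zero_less_divide_iff zero_less_numeral)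
    obtain i :: "'a \<Rightarrow> nat" and c where i [measurable]: "i \<in> borel_on X \<rightarrow>\<^sub>M count_space UNIV"
      and c: "\<And>x. x \<in> X \<Longrightarrow> c (i x) \<in> X" "\<And>x. x \<in> X \<Longrightarrow> dist (c (i x)) x < min \<delta> (\<epsilon>/4)"
      using compact_quantization[OF \<open>compact X\<close>, of "min \<delta> (\<epsilon>/4)"] \<open>\<delta> > 0\<close> \<open>\<epsilon> > 0\<close>
      by (metis min_less_iff_conj zero_less_divide_iff zero_less_numeral)
    obtain z where z: "\<And>x1 x2. x1 \<in> X \<Longrightarrow> x2 \<in> X \<Longrightarrow>
        z x1 x2 \<in> X \<and> dist (z x1 x2) x1 < \<epsilon>/4 \<and> dist (iter f n (z x1 x2)) (iter f n x2) < \<epsilon>/4"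
      using M[OF _ _ n] by metis
    have [measurable_cong]: "sets \<mu>1 = sets (borel_on X)" "sets \<mu>2 = sets (borel_on X)"
      using \<mu>1 \<mu>2 by (auto simp: borel_probs_def)
    have sp: "space \<mu>1 = X" "space \<mu>2 = X"
      using \<open>sets \<mu>1 = _\<close> \<open>sets \<mu>2 = _\<close> by (auto dest: sets_eq_imp_space_eq)
    interpret P1: prob_space \<mu>1 using \<mu>1 by (simp add: borel_probs_def)
    interpret P2: prob_space \<mu>2 using \<mu>2 by (simp add: borel_probs_def)
    interpret pair_prob_space \<mu>1 \<mu>2 ..
    let ?P = "\<mu>1 \<Otimes>\<^sub>M \<mu>2"
    define Z where "Z \<omega> = z (c (i (fst \<omega>))) (c (i (snd \<omega>)))" for \<omega>
    have ZX: "Z \<omega> \<in> X \<and> dist (Z \<omega>) (fst \<omega>) < \<epsilon>/2 \<and>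
        dist (iter f n (Z \<omega>)) (iter f n (snd \<omega>)) < \<epsilon>/2" if "\<omega> \<in> space ?P" for \<omega>
    proof -
      have "fst \<omega> \<in> X" "snd \<omega> \<in> X" using that by (auto simp: space_pair_measure sp)
      then show ?thesis
        using z[OF c(1) c(1), of "fst \<omega>" "snd \<omega>"] c(2)[of "fst \<omega>"]
          \<delta>[OF c(1) _, of "snd \<omega>" "snd \<omega>"] c(2)[of "snd \<omega>"]
          dist_triangle[of "Z \<omega>" "fst \<omega>" "c (i (fst \<omega>))"]
          dist_triangle[of "iter f n (Z \<omega>)" "iter f n (snd \<omega>)" "iter f n (c (i (snd \<omega>)))"]
        unfolding Z_def by auto
    qed
    \<comment> \<open>The choice \<open>z\<close> need not be measurable, but \<open>Z\<close> sees
      its argument only through two indices in \<open>nat\<close>, so it factors through a countable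
      discrete space.\<close>
    have "(\<lambda>\<omega>. (\<lambda>(j, k). z (c j) (c k)) (i (fst \<omega>), i (snd \<omega>))) \<in> ?P \<rightarrow>\<^sub>M borel"
      by measurable
    then have "Z \<in> ?P \<rightarrow>\<^sub>M borel" by (simp add: Z_def[abs_def])
    then have Z [measurable]: "Z \<in> ?P \<rightarrow>\<^sub>M borel_on X"
      unfolding borel_on_def using ZX by (intro measurable_restrict_space2) auto
    note [measurable] = measurable_iter[OF sys, of n]
    let ?L = "distr ?P (borel_on X) Z"
    have L: "?L \<in> borel_probs X" by (simp add: borel_probs_def prob_space_distr)
    \<comment> \<open>The marginals of the product are the given measures, so \<open>fst\<close> and
      \<open>snd\<close> are the variables with laws \<open>\<mu>1\<close> and \<open>\<mu>2\<close>
      that \<open>Z\<close> is compared with.\<close>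
    have m1: "distr ?P (borel_on X) fst = \<mu>1"
    proof -
      have "distr ?P (borel_on X) fst = distr ?P \<mu>1 fst"
        by (rule distr_cong) (simp_all add: \<open>sets \<mu>1 = _\<close>)
      then show ?thesis by (simp add: P2.distr_pair_fst)
    qed
    have m2: "distr ?P (borel_on X) snd = \<mu>2"
    proof (rule measure_eqI)
      fix A assume "A \<in> sets (distr ?P (borel_on X) snd)"
      then have A: "A \<in> sets \<mu>2" by (simp add: \<open>sets \<mu>2 = _\<close>)
      then have "snd -` A \<inter> space ?P = space \<mu>1 \<times> A"
        using sets.sets_into_space by (fastforce simp: space_pair_measure)
      with A show "emeasure (distr ?P (borel_on X) snd) A = emeasure \<mu>2 A"
        by (simp add: emeasure_distr \<open>sets \<mu>2 = _\<close> P2.emeasure_pair_measure_Times P1.emeasure_space_1)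
    qed (simp add: \<open>sets \<mu>2 = _\<close>)
    have "prohorov X ?L (distr ?P (borel_on X) fst) < \<epsilon>"
      by (rule prohorov_distr_less[where \<delta>="\<epsilon>/2"])
        (use ZX \<open>\<epsilon> > 0\<close> prob_space_axioms in auto)
    moreover have "prohorov X (distr ?P (borel_on X) (iter f n \<circ> Z))
        (distr ?P (borel_on X) (iter f n \<circ> snd)) < \<epsilon>"
      by (rule prohorov_distr_less[where \<delta>="\<epsilon>/2"])
        (use ZX \<open>\<epsilon> > 0\<close> prob_space_axioms in auto)
    moreover have "iter (induced X f) n ?L = distr ?P (borel_on X) (iter f n \<circ> Z)"
      by (simp add: iter_induced[OF sys L] distr_distr)
    moreover have "distr (distr ?P (borel_on X) snd) (borel_on X) (iter f n)
        = distr ?P (borel_on X) (iter f n \<circ> snd)"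
      by (simp add: distr_distr)
    then have "iter (induced X f) n \<mu>2 = distr ?P (borel_on X) (iter f n \<circ> snd)"
      by (simp add: m2 iter_induced[OF sys \<mu>2])
    ultimately have "prohorov X ?L \<mu>1 < \<epsilon>"
      "prohorov X (iter (induced X f) n ?L) (iter (induced X f) n \<mu>2) < \<epsilon>"
      by (simp_all add: m1)
    then show ?thesis using L by blast
  qed
  with \<open>M > 0\<close> show "\<exists>M>0. \<forall>\<mu>1\<in>borel_probs X. \<forall>\<mu>2\<in>borel_probs X. \<forall>n\<ge>M. \<exists>\<kappa>\<in>borel_probs X.
      prohorov X \<kappa> \<mu>1 < \<epsilon> \<and> prohorov X (iter (induced X f) n \<kappa>) (iter (induced X f) n \<mu>2) < \<epsilon>"
    by blast
qed

text \<open>Test the Prohorov inequality on \<open>{x}\<close>: the Dirac measure gives it mass 1,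
  and its neighbourhood is a ball. An admissible \<open>\<delta>\<close> strictly below
  \<open>\<epsilon>\<close> makes the bound strict.\<close>

lemma prohorov_return_less:
  assumes "\<kappa> \<in> borel_probs X" "x \<in> X" "prohorov X \<kappa> (return (borel_on X) x) < \<epsilon>"
  shows "measure \<kappa> (ball x \<epsilon> \<inter> X) > 1 - \<epsilon>"
proof -
  have R: "return (borel_on X) x \<in> borel_probs X"
    using assms(2) by (simp add: borel_probs_def prob_space_return)
  obtain \<delta> where "\<delta> < \<epsilon>" and \<delta>: "\<And>A. A \<in> sets (borel_on X) \<Longrightarrow>
      measure (return (borel_on X) x) A \<le> measure \<kappa> (nbhd X A \<delta>) + \<delta>"
    using assms(3) unfolding prohorov_less_iff[OF assms(1) R] by blast
  have x: "{x} \<in> sets (borel_on X)"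
    using assms(2) unfolding borel_on_def sets_restrict_space
    by (intro image_eqI[of _ _ "{x}"]) auto
  then have "1 - \<delta> \<le> measure \<kappa> (nbhd X {x} \<delta>)"
    using \<delta>[OF x] by (simp add: measure_return)
  also have "\<dots> \<le> measure \<kappa> (nbhd X {x} \<epsilon>)"
  proof -
    interpret prob_space \<kappa> using assms(1) by (simp add: borel_probs_def)
    show ?thesis
    proof (rule finite_measure_mono)
      show "nbhd X {x} \<delta> \<subseteq> nbhd X {x} \<epsilon>" using \<open>\<delta> < \<epsilon>\<close> by (auto simp: nbhd_def)
      show "nbhd X {x} \<epsilon> \<in> sets \<kappa>" using assms(1) nbhd_sets by (auto simp: borel_probs_def)
    qed
  qed
  finally show ?thesis using \<open>\<delta> < \<epsilon>\<close> by (simp add: nbhd_def)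
qed

lemma QSP_base:
  assumes sys: "nonautonomous_system X f"
    and "QSP (borel_probs X) (prohorov X) (induced X f)"
  shows "QSP X dist f"
  unfolding QSP_def
proof (intro allI impI)
  fix \<epsilon> :: real assume "\<epsilon> > 0"
  \<comment> \<open>The bound \<open>\<epsilon>\<close> keeps the balls small enough; the bound
    \<open>1/2\<close> makes two events of mass above \<open>1 - \<eta>\<close> too large to be
    disjoint.\<close>
  define \<eta> where "\<eta> = min \<epsilon> (1/2)"
  have \<eta>: "\<eta> > 0" "\<eta> \<le> \<epsilon>" "\<eta> \<le> 1/2" using \<open>\<epsilon> > 0\<close> by (auto simp: \<eta>_def)
  obtain M where "M > 0" and M: "\<And>\<mu>1 \<mu>2 n. \<mu>1 \<in> borel_probs X \<Longrightarrow> \<mu>2 \<in> borel_probs X \<Longrightarrow> n \<ge> M \<Longrightarrow>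
      \<exists>\<kappa>\<in>borel_probs X. prohorov X \<kappa> \<mu>1 < \<eta> \<and>
        prohorov X (iter (induced X f) n \<kappa>) (iter (induced X f) n \<mu>2) < \<eta>"
    using assms(2) \<eta>(1) unfolding QSP_def by metis
  have "\<exists>z\<in>X. dist z x1 < \<epsilon> \<and> dist (iter f n z) (iter f n x2) < \<epsilon>"
    if x: "x1 \<in> X" "x2 \<in> X" and n: "n \<ge> M" for x1 x2 n
  proof -
    have R: "return (borel_on X) x \<in> borel_probs X" if "x \<in> X" for x
      using that by (simp add: borel_probs_def prob_space_return)
    obtain \<kappa> where \<kappa>: "\<kappa> \<in> borel_probs X" and
      1: "prohorov X \<kappa> (return (borel_on X) x1) < \<eta>" and
      2: "prohorov X (iter (induced X f) n \<kappa>) (iter (induced X f) n (return (borel_on X) x2)) < \<eta>"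
      using M[OF R R n] x by blast
    interpret prob_space \<kappa> using \<kappa> by (simp add: borel_probs_def)
    have s [measurable_cong]: "sets \<kappa> = sets (borel_on X)" using \<kappa> by (simp add: borel_probs_def)
    then have sp: "space \<kappa> = X" by (auto dest: sets_eq_imp_space_eq)
    note [measurable] = measurable_iter[OF sys, of n]
    have b: "ball x \<eta> \<inter> X \<in> sets (borel_on X)" for x
      using nbhd_sets[of X "{x}" \<eta>] by (simp add: nbhd_def)
    let ?y = "iter f n x2"
    have y: "?y \<in> X" using iter_continuous_surj[OF sys, of n] x by auto
    have D: "distr \<kappa> (borel_on X) (iter f n) \<in> borel_probs X"
      by (simp add: borel_probs_def prob_space_distr)
    \<comment> \<open>The image of a Dirac measure is the Dirac measure at the image point, so the
      previous lemma applies at time \<open>n\<close> too. Pulling its ball back along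
      \<open>iter f n\<close> gives a second large set for the same measure
      \<open>\<kappa>\<close>.\<close>
    have "prohorov X (distr \<kappa> (borel_on X) (iter f n)) (return (borel_on X) ?y) < \<eta>"
      using 2 x by (simp add: iter_induced[OF sys] \<kappa> R distr_return)
    from prohorov_return_less[OF D y this]
    have "measure \<kappa> (iter f n -` (ball ?y \<eta> \<inter> X) \<inter> X) > 1 - \<eta>"
      using b by (subst (asm) measure_distr) (auto simp: sp)
    moreover have "measure \<kappa> (ball x1 \<eta> \<inter> X) > 1 - \<eta>"
      by (rule prohorov_return_less[OF \<kappa> x(1) 1])
    \<comment> \<open>Disjointness would cap the sum of the masses at 1, whereas it exceeds
      \<open>2 - 2 * \<eta>\<close>, which is at least 1; a common point is the required
      \<open>z\<close>.\<close>
    moreover have "measure \<kappa> (ball x1 \<eta> \<inter> X) + measure \<kappa> (iter f n -` (ball ?y \<eta> \<inter> X) \<inter> X) \<le> 1"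
      if "(ball x1 \<eta> \<inter> X) \<inter> (iter f n -` (ball ?y \<eta> \<inter> X) \<inter> X) = {}"
    proof -
      have "iter f n -` (ball ?y \<eta> \<inter> X) \<inter> space (borel_on X) \<in> sets (borel_on X)"
        by (rule measurable_sets[OF _ b]) measurable
      then show ?thesis
        using finite_measure_Union[OF _ _ that, symmetric] b by (simp only: s space_borel_on prob_le_1)
    qed
    ultimately obtain z where "z \<in> X" "dist x1 z < \<eta>" "dist ?y (iter f n z) < \<eta>"
      using \<eta>(3) by fastforce
    then show ?thesis using \<eta>(2) by (auto simp: dist_commute intro!: bexI[of _ z])
  qed
  with \<open>M > 0\<close> show "\<exists>M>0. \<forall>x1\<in>X. \<forall>x2\<in>X. \<forall>n\<ge>M.
      \<exists>z\<in>X. dist z x1 < \<epsilon> \<and> dist (iter f n z) (iter f n x2) < \<epsilon>"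
    by blast
qed

theorem corollary5p2:
  fixes X :: "'a::metric_space set" and f :: "nat \<Rightarrow> 'a \<Rightarrow> 'a"
  assumes "nonautonomous_system X f"
  shows "QSP X dist f \<longleftrightarrow> QSP (borel_probs X) (prohorov X) (induced X f)"
  using QSP_induced[OF assms] QSP_base[OF assms] by blast

end
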